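(* Let $H:\mathbb{R}^n\times\mathbb{T}^n\to\mathbb{R}$, $u_k$, $\sigma_k$, $\Phi^t$, $\Phi^t_H$ and $d_k$ be as in the context, and let $\lambda_H>0$ be a Lipschitz constant for the Hamiltonian vector field $X_H=\big(-\frac{\partial H}{\partial\varphi},\frac{\partial H}{\partial I}\big)$. Let $R>0$ and let $C^R>0$ be a constant such that $$\int_{\mathbb{T}^n}\Big|\frac{\partial I^t}{\partial t}(\tilde I,\varphi)+\frac{\partial H}{\partial\varphi}\big(\Phi^t(\tilde I,\varphi)\big)\Big|^2\sigma_k(\tilde I,\varphi)\,d\varphi\le\frac{C^R}{k}$$ for all $t\in\mathbb{R}$, all integers $k\ge1$ and all $\tilde I\in\mathbb{R}^n$ with $|\tilde I|\le R$. Then $$\int_{\mathbb{T}^n} d_k(t,\tilde I,\varphi)\,\sigma_k(\tilde I,\varphi)\,d\varphi\le\frac{(e^{\lambda_H t}-1)(1+C^R)}{\lambda_H\sqrt{k}}$$ for all $t\in\mathbb{R}$, all integers $k\ge 1$ and all $|\tilde I|\le R$. In particular, $$\lim_{k\to+\infty}\int_{\mathbb{T}^n} d_k(t,\tilde I,\varphi)\,\sigma_k(\tilde I,\varphi)\,d\varphi=0$$ for all $t\in\mathbb{R}$ and $|\tilde I|\le R$.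
   Context: Setting. $\mathbb{T}^n=(\mathbb{R}/2\pi\mathbb{Z})^n$. $H(I,\varphi)$ is a smooth function on $\mathbb{R}^n\times\mathbb{T}^n$, convex in $I$, and there is $C>0$ such that for all $(I,\varphi)$: $\max\Big\{\big|\frac{\partial^2H}{\partial I^2}\big|,\ \frac{|\partial^2H/\partial I\partial\varphi|}{1+|I|},\ \frac{|\partial^2H/\partial\varphi^2|}{1+|I|^2}\Big\}\le C$. For every $\tilde I\in\mathbb{R}^n$ and every integer $k\ge1$, $u_k(\tilde I,\cdot)$ denotes the minimizer on $\mathbb{T}^n$ of the functional $I_k[u]=\int_{\mathbb{T}^n}e^{kH(\tilde I+\partial u/\partial\varphi,\varphi)}d\varphi$ with $\int_{\mathbb{T}^n}u_k\,d\varphi=0$; it is part of the standing setting that this minimizer exists, is unique and is smooth. Definitions. $\bar H_k(\tilde I)=\frac1k\log\int_{\mathbb{T}^n}e^{kH(\tilde I+\frac{\partial u_k}{\partial\varphi},\varphi)}d\varphi$ and $\sigma_k(\tilde I,\varphi)=e^{k(H(\tilde I+\frac{\partial u_k}{\partial\varphi}(\tilde I,\varphi),\varphi)-\bar H_k(\tilde I))}$ (so $\int_{\mathbb{T}^n}\sigma_k\,d\varphi=1$). Put $U_I(\tilde I,\varphi)=\tilde I+\frac{\partial u_k}{\partial\varphi}(\tilde I,\varphi)$. For fixed $\tilde I$, $\mathcal{C}^t_{\tilde I}(\varphi)$ is the flow on $\mathbb{T}^n$ of $\dot\varphi=\frac{\partial H}{\partial I}\big(\tilde I+\frac{\partial u_k}{\partial\varphi}(\tilde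 I,\varphi),\varphi\big)$. Define $\Phi^t(\tilde I,\varphi)=(I^t,\varphi^t):=\big(U_I(\tilde I,\mathcal{C}^t_{\tilde I}(\varphi)),\,\mathcal{C}^t_{\tilde I}(\varphi)\big)$. $\Phi^t_H$ denotes the Hamiltonian flow of $H$, i.e. the flow of $X_H$, and $(I^t_H,\varphi^t_H):=\Phi^t_H(U_I(\tilde I,\varphi),\varphi)$. Finally $$d_k(t,\tilde I,\varphi):=\big|\Phi^t(\tilde I,\varphi)-\Phi^t_H(U_I(\tilde I,\varphi),\varphi)\big|=\big|(I^t-I^t_H,\ \varphi^t-\varphi^t_H)\big|,$$ the Euclidean norm in $\mathbb{R}^{2n}$, where the angular curves are lifted to $\mathbb{R}^n$ starting from the same lift of $\varphi$; the Lipschitz constant $\lambda_H$ is with respect to the Euclidean norm for the lift of $X_H$ to $\mathbb{R}^{2n}$.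
   Formalization: The bound is proved with e^{λ_H|t|} in place of e^{λ_H t}: for t<0 the printed right-hand side is negative while the left-hand side is nonnegative, so it is false there (e.g. H=|I|²/2, u_k=0); for t≥0 the two bounds coincide. *)

theory Defs
  imports "HOL-Analysis.Analysis"
begin

text \<open>
  The torus is \<open>\<T>\<^sup>n = (\<real> / 2\<pi>\<int>)\<^sup>n\<close>. Functions on it are represented by their lifts to \<^typ>\<open>real^'n\<close>,
  i.e. by functions that are \<open>2\<pi>\<close>-periodic in every coordinate, and angular curves by their lifts.
  Phase space points are pairs \<open>(I, \<phi>)\<close>; the norm of the product type is the Euclidean norm of
  \<open>\<real>\<^sup>2\<^sup>n\<close>.
\<close>

definition torus_periodic :: "(real^'n \<Rightarrow> 'b) \<Rightarrow> bool" where
  "torus_periodic f \<longleftrightarrow> (\<forall>\<phi> i. f (\<phi> + axis i (2 * pi)) = f \<phi>)"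

definition torus_integral :: "(real^'n \<Rightarrow> real) \<Rightarrow> real" where
  "torus_integral f = (LINT \<phi>:cbox 0 (\<chi> i. 2 * pi)|lborel. f \<phi>)"

primrec C_k :: "nat \<Rightarrow> ('a::euclidean_space \<Rightarrow> real) \<Rightarrow> bool" where
  "C_k 0 f \<longleftrightarrow> continuous_on UNIV f"
| "C_k (Suc m) f \<longleftrightarrow>
     (\<forall>x. f differentiable (at x)) \<and> (\<forall>b\<in>Basis. C_k m (\<lambda>x. frechet_derivative f (at x) b))"

definition smooth :: "('a::euclidean_space \<Rightarrow> real) \<Rightarrow> bool" where
  "smooth f \<longleftrightarrow> (\<forall>m. C_k m f)"

definition grad :: "(real^'n \<Rightarrow> real) \<Rightarrow> real^'n \<Rightarrow> real^'n" where
  "grad f x = (\<chi> i. frechet_derivative f (at x) (axis i 1))"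

definition dH_dI :: "((real^'n) \<times> (real^'n) \<Rightarrow> real) \<Rightarrow> (real^'n) \<times> (real^'n) \<Rightarrow> real^'n" where
  "dH_dI H z = grad (\<lambda>J. H (J, snd z)) (fst z)"

definition dH_dphi :: "((real^'n) \<times> (real^'n) \<Rightarrow> real) \<Rightarrow> (real^'n) \<times> (real^'n) \<Rightarrow> real^'n" where
  "dH_dphi H z = grad (\<lambda>\<psi>. H (fst z, \<psi>)) (snd z)"

text \<open>
  The blocks of the Hessian, as linear maps, measured in the operator norm. The choice of matrix norm
  is immaterial because the constant \<open>C\<close> is existentially quantified.
\<close>

definition hessian_bounds :: "((real^'n) \<times> (real^'n) \<Rightarrow> real) \<Rightarrow> bool" where
  "hessian_bounds H \<longleftrightarrow> (\<exists>C>0. \<forall>I \<phi>.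
     Max {onorm (frechet_derivative (\<lambda>J. dH_dI H (J, \<phi>)) (at I)),
          onorm (frechet_derivative (\<lambda>\<psi>. dH_dI H (I, \<psi>)) (at \<phi>)) / (1 + norm I),
          onorm (frechet_derivative (\<lambda>\<psi>. dH_dphi H (I, \<psi>)) (at \<phi>)) / (1 + (norm I)\<^sup>2)} \<le> C)"

definition hamiltonian_field ::
  "((real^'n) \<times> (real^'n) \<Rightarrow> real) \<Rightarrow> (real^'n) \<times> (real^'n) \<Rightarrow> (real^'n) \<times> (real^'n)" where
  "hamiltonian_field H z = (- dH_dphi H z, dH_dI H z)"

definition is_flow :: "('a::real_normed_vector \<Rightarrow> 'a) \<Rightarrow> (real \<Rightarrow> 'a \<Rightarrow> 'a) \<Rightarrow> bool" where
  "is_flow X \<Psi> \<longleftrightarrow>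
     (\<forall>x. \<Psi> 0 x = x \<and> (\<forall>t. ((\<lambda>s. \<Psi> s x) has_vector_derivative X (\<Psi> t x)) (at t)))"

text \<open>The functional \<open>I\<^sub>k[v]\<close> at the parameter \<open>I\<close>.\<close>

definition exp_functional ::
  "((real^'n) \<times> (real^'n) \<Rightarrow> real) \<Rightarrow> nat \<Rightarrow> real^'n \<Rightarrow> (real^'n \<Rightarrow> real) \<Rightarrow> real" where
  "exp_functional H k I v = torus_integral (\<lambda>\<phi>. exp (real k * H (I + grad v \<phi>, \<phi>)))"

text \<open>
  Competitors are all smooth functions on the torus. A smooth function that minimizes the functional
  over a larger class (\<open>C\<^sup>1\<close>, Lipschitz, ...) is in particular a minimizer in this sense.
\<close>

definition is_minimizer ::
  "((real^'n) \<times> (real^'n) \<Rightarrow> real) \<Rightarrow> nat \<Rightarrow> real^'n \<Rightarrow> (real^'n \<Rightarrow> real) \<Rightarrow> bool" where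
  "is_minimizer H k I v \<longleftrightarrow>
     smooth v \<and> torus_periodic v \<and> torus_integral v = 0 \<and>
     (\<forall>w. smooth w \<and> torus_periodic w \<longrightarrow> exp_functional H k I v \<le> exp_functional H k I w)"

definition is_unique_minimizer ::
  "((real^'n) \<times> (real^'n) \<Rightarrow> real) \<Rightarrow> nat \<Rightarrow> real^'n \<Rightarrow> (real^'n \<Rightarrow> real) \<Rightarrow> bool" where
  "is_unique_minimizer H k I v \<longleftrightarrow>
     is_minimizer H k I v \<and> (\<forall>w. is_minimizer H k I w \<longrightarrow> w = v)"

text \<open>In what follows \<open>u k I\<close> is the function \<open>u\<^sub>k(I, \<cdot>)\<close>.\<close>

definition U_I :: "(nat \<Rightarrow> real^'n \<Rightarrow> real^'n \<Rightarrow> real) \<Rightarrow> nat \<Rightarrow> real^'n \<Rightarrow> real^'n \<Rightarrow> real^'n" where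
  "U_I u k I \<phi> = I + grad (u k I) \<phi>"

definition H_bar ::
  "((real^'n) \<times> (real^'n) \<Rightarrow> real) \<Rightarrow> (nat \<Rightarrow> real^'n \<Rightarrow> real^'n \<Rightarrow> real) \<Rightarrow> nat \<Rightarrow> real^'n \<Rightarrow> real"
  where
  "H_bar H u k I = 1 / real k * ln (exp_functional H k I (u k I))"

definition sigma_k ::
  "((real^'n) \<times> (real^'n) \<Rightarrow> real) \<Rightarrow> (nat \<Rightarrow> real^'n \<Rightarrow> real^'n \<Rightarrow> real)
    \<Rightarrow> nat \<Rightarrow> real^'n \<Rightarrow> real^'n \<Rightarrow> real" where
  "sigma_k H u k I \<phi> = exp (real k * (H (U_I u k I \<phi>, \<phi>) - H_bar H u k I))"

text \<open>The vector field on the torus whose flow is \<open>\<C>\<^sup>t\<close>.\<close>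

definition angle_field ::
  "((real^'n) \<times> (real^'n) \<Rightarrow> real) \<Rightarrow> (nat \<Rightarrow> real^'n \<Rightarrow> real^'n \<Rightarrow> real)
    \<Rightarrow> nat \<Rightarrow> real^'n \<Rightarrow> real^'n \<Rightarrow> real^'n" where
  "angle_field H u k I \<phi> = dH_dI H (U_I u k I \<phi>, \<phi>)"

text \<open>\<open>Cf k I\<close> is the flow of \<open>angle_field H u k I\<close>, lifted to \<open>\<real>\<^sup>n\<close>.\<close>

definition Phi ::
  "(nat \<Rightarrow> real^'n \<Rightarrow> real^'n \<Rightarrow> real) \<Rightarrow> (nat \<Rightarrow> real^'n \<Rightarrow> real \<Rightarrow> real^'n \<Rightarrow> real^'n)
    \<Rightarrow> nat \<Rightarrow> real \<Rightarrow> real^'n \<Rightarrow> real^'n \<Rightarrow> (real^'n) \<times> (real^'n)" where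
  "Phi u Cf k t I \<phi> = (U_I u k I (Cf k I t \<phi>), Cf k I t \<phi>)"

definition flow_dist ::
  "(nat \<Rightarrow> real^'n \<Rightarrow> real^'n \<Rightarrow> real) \<Rightarrow> (nat \<Rightarrow> real^'n \<Rightarrow> real \<Rightarrow> real^'n \<Rightarrow> real^'n)
    \<Rightarrow> (real \<Rightarrow> (real^'n) \<times> (real^'n) \<Rightarrow> (real^'n) \<times> (real^'n))
    \<Rightarrow> nat \<Rightarrow> real \<Rightarrow> real^'n \<Rightarrow> real^'n \<Rightarrow> real" where
  "flow_dist u Cf PhiH k t I \<phi> = norm (Phi u Cf k t I \<phi> - PhiH t (U_I u k I \<phi>, \<phi>))"

end

theory Submission
  imports Defs
begin

text \<open>
  The curve \<open>\<Phi>\<^sup>t\<close> solves Hamilton's equations up to the error \<open>\<partial>I\<^sup>t/\<partial>t + \<partial>H/\<partial>\<phi>\<close> in the momentum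
  component, so Gronwall's inequality bounds \<open>d\<^sub>k(t)\<close> by \<open>\<integral>\<^sub>0\<^sup>t e\<^bsup>\<lambda>(t - s)\<^esup> |error(s)| ds\<close> (negative times
  are handled by time reversal). Integrating against \<open>\<sigma>\<^sub>k\<close> and exchanging the integrals reduces
  the claim to the mean of \<open>|error|\<close>, which the hypothesis on \<open>|error|\<^sup>2\<close> controls because \<open>\<sigma>\<^sub>k\<close> has
  total mass 1. The exchange needs the flow \<open>\<C>\<^sup>t\<close> to be jointly continuous: its vector field
  is globally Lipschitz, since \<open>X\<^sub>H\<close> is and the second derivatives of the periodic function \<open>u\<^sub>k\<close>
  are bounded.
\<close>

section \<open>Gronwall estimates and flows of Lipschitz vector fields\<close>

text \<open>Since \<open>norm (w s)\<close> need not be differentiable where \<open>w\<close>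
  vanishes, it is replaced by the differentiable majorant \<open>v\<close>, the integral of the
  assumed bound on the speed, and the integrating factor is applied to \<open>v\<close>.\<close>

lemma gronwall_norm:
  fixes w f :: "real \<Rightarrow> 'a::euclidean_space" and g :: "real \<Rightarrow> real"
  assumes w: "\<And>s. (w has_vector_derivative f s) (at s)"
    and f_le: "\<And>s. norm (f s) \<le> L * norm (w s) + g s"
    and g: "continuous_on UNIV g" and L: "L \<ge> 0" and t: "t \<ge> 0"
  shows "norm (w t) \<le> exp (L * t) * (norm (w 0) + integral {0..t} (\<lambda>s. exp (- L * s) * g s))"
proof -
  define b where "b s = L * norm (w s) + g s" for s
  define v where "v s = norm (w 0) + integral {0..s} b" for s
  \<comment> \<open>The derivative of \<open>h\<close> is
    \<open>exp (- L * s) * L * (norm (w s) - v s)\<close>, which is nonpositive because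
    \<open>v\<close> dominates \<open>norm (w s)\<close>. Comparing \<open>h t\<close> with
    \<open>h 0\<close> is then the claim for \<open>v\<close>.\<close>
  define h where "h s = exp (- L * s) * v s - integral {0..s} (\<lambda>s. exp (- L * s) * g s)" for s
  have cw: "continuous_on S w" for S
    using w by (meson continuous_at_imp_continuous_on has_vector_derivative_continuous)
  have cg: "continuous_on S g" for S
    using g continuous_on_subset by blast
  have cb: "continuous_on S b" for S
    unfolding b_def by (intro continuous_intros cw cg)
  have ceg: "continuous_on S (\<lambda>s. exp (- L * s) * g s)" for S
    by (intro continuous_intros cg)
  have w_le: "norm (w s) \<le> v s" if "s \<ge> 0" for s
  proof -
    have hi: "(f has_integral (w s - w 0)) {0..s}"
      by (rule fundamental_theorem_of_calculus[OF that])
        (use w has_vector_derivative_at_within in blast)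
    have "norm (integral {0..s} f) \<le> integral {0..s} b"
      using f_le by (intro integral_norm_bound_integral has_integral_integrable[OF hi]
          integrable_continuous_real cb) (simp add: b_def)
    then have "norm (w s - w 0) \<le> integral {0..s} b"
      using hi by (simp add: integral_unique)
    then show ?thesis
      unfolding v_def by (smt (verit) norm_triangle_sub)
  qed
  have dint: "((\<lambda>s. integral {0..s} q) has_real_derivative q s) (at s within {0..t})"
    if "s \<in> {0..t}" "\<And>S. continuous_on S q" for s and q :: "real \<Rightarrow> real"
    using integral_has_vector_derivative[OF that(2) that(1)]
    by (simp add: has_real_derivative_iff_has_vector_derivative)
  have dh: "(h has_real_derivative exp (- L * s) * (b s - L * v s - g s)) (at s within {0..t})"
    if "s \<in> {0..t}" for s
    unfolding h_def v_def
    by (rule derivative_eq_intros dint[OF that] cb ceg refl | simp add: algebra_simps)+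
  have "h t \<le> h 0"
  proof (rule DERIV_nonpos_imp_decreasing_open[OF t])
    fix s assume s: "0 < s" "s < t"
    then have "(h has_real_derivative exp (- L * s) * (b s - L * v s - g s)) (at s)"
      using dh[of s] by (simp add: at_within_Icc_at)
    moreover have "b s - L * v s - g s \<le> 0"
      using mult_left_mono[OF w_le[of s] L] s by (simp add: b_def)
    ultimately show "\<exists>y. (h has_real_derivative y) (at s) \<and> y \<le> 0"
      by (meson exp_ge_zero mult_nonneg_nonpos)
  next
    show "continuous_on {0..t} h"
      by (rule DERIV_continuous_on[OF dh])
  qed
  then have "exp (- L * t) * v t \<le> norm (w 0) + integral {0..t} (\<lambda>s. exp (- L * s) * g s)"
    by (simp add: h_def v_def)
  from mult_left_mono[OF this, of "exp (L * t)"]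
  have "v t \<le> exp (L * t) * (norm (w 0) + integral {0..t} (\<lambda>s. exp (- L * s) * g s))"
    by (simp add: mult.assoc[symmetric] exp_add[symmetric])
  with w_le[OF t] show ?thesis by linarith
qed

text \<open>Time reversal: the forward estimate is applied at time \<open>\<bar>t\<bar>\<close> to
  the curve run in the direction \<open>sgn t\<close>.\<close>

lemma gronwall_norm_abs:
  fixes w f :: "real \<Rightarrow> 'a::euclidean_space" and g :: "real \<Rightarrow> real"
  assumes w: "\<And>s. (w has_vector_derivative f s) (at s)"
    and f_le: "\<And>s. norm (f s) \<le> L * norm (w s) + g s"
    and g: "continuous_on UNIV g" and L: "L \<ge> 0"
  shows "norm (w t) \<le>
    exp (L * \<bar>t\<bar>) * (norm (w 0) + integral {0..\<bar>t\<bar>} (\<lambda>s. exp (- L * s) * g (sgn t * s)))"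
proof -
  \<comment> \<open>For \<open>t \<noteq> 0\<close> the factor \<open>sgn t\<close> has modulus 1,
    so reparametrising keeps the norm of the velocity; for \<open>t = 0\<close> both sides
    agree.\<close>
  have "norm ((w \<circ> (\<lambda>s. sgn t * s)) \<bar>t\<bar>) \<le> exp (L * \<bar>t\<bar>) * (norm ((w \<circ> (\<lambda>s. sgn t * s)) 0)
    + integral {0..\<bar>t\<bar>} (\<lambda>s. exp (- L * s) * g (sgn t * s)))" if "t \<noteq> 0"
  proof (rule gronwall_norm)
    show "((w \<circ> (\<lambda>s. sgn t * s)) has_vector_derivative sgn t *\<^sub>R f (sgn t * s)) (at s)" for s
      by (rule vector_diff_chain_at[OF _ w]) (auto intro!: derivative_eq_intros)
    show "norm (sgn t *\<^sub>R f (sgn t * s)) \<le> L * norm ((w \<circ> (\<lambda>s. sgn t * s)) s) + g (sgn t * s)" for s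
      using f_le[of "sgn t * s"] that by (simp add: abs_sgn_eq)
    show "continuous_on UNIV (\<lambda>s. g (sgn t * s))"
      by (rule continuous_on_compose2[OF g]) (auto intro!: continuous_intros)
  qed (use L in auto)
  then show ?thesis
    by (cases "t = 0") (simp_all add: mult_sgn_abs)
qed

text \<open>Gronwall with zero error term, applied to the difference of two trajectories.\<close>

lemma flow_lipschitz_initial:
  fixes X :: "'a::euclidean_space \<Rightarrow> 'a"
  assumes X: "L-lipschitz_on UNIV X" and F: "is_flow X F"
  shows "norm (F t x - F t y) \<le> exp (L * \<bar>t\<bar>) * norm (x - y)"
proof -
  have F0: "F 0 x = x" and dF: "((\<lambda>s. F s x) has_vector_derivative X (F s x)) (at s)" for x s
    using F by (auto simp: is_flow_def)
  have "norm (F t x - F t y) \<le> exp (L * \<bar>t\<bar>) * (norm (F 0 x - F 0 y)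
    + integral {0..\<bar>t\<bar>} (\<lambda>s. exp (- L * s) * 0))"
  proof (rule gronwall_norm_abs)
    show "((\<lambda>s. F s x - F s y) has_vector_derivative X (F s x) - X (F s y)) (at s)" for s
      by (intro has_vector_derivative_diff dF)
    show "norm (X (F s x) - X (F s y)) \<le> L * norm (F s x - F s y) + 0" for s
      using lipschitz_on_normD[OF X] by simp
  qed (use lipschitz_on_nonneg[OF X] in simp_all)
  then show ?thesis by (simp add: F0)
qed

text \<open>First move the initial point at fixed time, which costs a factor locally bounded in
  time, then move the time along one fixed trajectory.\<close>

lemma continuous_on_flow:
  fixes X :: "'a::euclidean_space \<Rightarrow> 'a"
  assumes X: "L-lipschitz_on UNIV X" and F: "is_flow X F"
  shows "continuous_on UNIV (\<lambda>z. F (fst z) (snd z))"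
proof (rule continuous_at_imp_continuous_on, rule ballI)
  fix z :: "real \<times> 'a"
  have dF: "((\<lambda>s. F s x) has_vector_derivative X (F s x)) (at s)" for x s
    using F by (auto simp: is_flow_def)
  have c: "isCont (\<lambda>s. F s x) s" for x s
    using dF has_vector_derivative_continuous by blast
  have F_fst: "((\<lambda>y. F (fst y) (snd z)) \<longlongrightarrow> F (fst z) (snd z)) (at z)"
    by (rule isCont_tendsto_compose[OF c]) (intro tendsto_intros)
  have lim: "((\<lambda>y. exp (L * \<bar>fst y\<bar>) * norm (snd y - snd z) + norm (F (fst y) (snd z) - F (fst z) (snd z)))
    \<longlongrightarrow> exp (L * \<bar>fst z\<bar>) * norm (snd z - snd z) + norm (F (fst z) (snd z) - F (fst z) (snd z))) (at z)"
    by (intro tendsto_intros F_fst)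
  have "((\<lambda>y. F (fst y) (snd y) - F (fst z) (snd z)) \<longlongrightarrow> 0) (at z)"
  proof (rule Lim_null_comparison)
    show "\<forall>\<^sub>F y in at z. norm (F (fst y) (snd y) - F (fst z) (snd z)) \<le>
      exp (L * \<bar>fst y\<bar>) * norm (snd y - snd z) + norm (F (fst y) (snd z) - F (fst z) (snd z))"
    proof (rule always_eventually, rule allI)
      fix y :: "real \<times> 'a"
      show "norm (F (fst y) (snd y) - F (fst z) (snd z)) \<le>
        exp (L * \<bar>fst y\<bar>) * norm (snd y - snd z) + norm (F (fst y) (snd z) - F (fst z) (snd z))"
        using flow_lipschitz_initial[OF X F, of "fst y" "snd y" "snd z"]
          norm_triangle_ineq[of "F (fst y) (snd y) - F (fst y) (snd z)" "F (fst y) (snd z) - F (fst z) (snd z)"]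
        by simp
    qed
    show "((\<lambda>y. exp (L * \<bar>fst y\<bar>) * norm (snd y - snd z) + norm (F (fst y) (snd z) - F (fst z) (snd z)))
      \<longlongrightarrow> 0) (at z)"
      using lim by simp
  qed
  then show "isCont (\<lambda>z. F (fst z) (snd z)) z"
    by (simp add: isCont_def LIM_zero_iff)
qed

section \<open>Periodic functions and their derivatives\<close>

lemma torus_periodic_shift:
  fixes f :: "real^'n \<Rightarrow> 'b" and m :: "'n \<Rightarrow> int"
  assumes "torus_periodic f"
  shows "f (x + (\<chi> i. 2 * pi * of_int (m i))) = f x"
proof -
  have up: "f (x + axis i (2 * pi)) = f x" for x i
    using assms by (simp add: torus_periodic_def)
  have one: "f (x + axis i (2 * pi * of_int k)) = f x" for x i k
  proof (induction k rule: int_induct[where k = 0])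
    case base
    show ?case by (simp add: axis_eq_0_iff[THEN iffD2])
  next
    case (step1 k)
    have "axis i (2 * pi * of_int (k + 1)) = axis i (2 * pi * of_int k) + (axis i (2 * pi) :: real^'n)"
      by (simp add: vec_eq_iff axis_def algebra_simps)
    with up[of "x + axis i (2 * pi * of_int k)" i] step1 show ?case
      by (simp add: add.assoc)
  next
    case (step2 k)
    have "axis i (2 * pi * of_int k) = axis i (2 * pi * of_int (k - 1)) + (axis i (2 * pi) :: real^'n)"
      by (simp add: vec_eq_iff axis_def algebra_simps)
    with up[of "x + axis i (2 * pi * of_int (k - 1))" i] step2 show ?case
      by (simp add: add.assoc)
  qed
  \<comment> \<open>The lattice vector is assembled one coordinate at a time.\<close>
  have "f (x + (\<Sum>i\<in>S. axis i (2 * pi * of_int (m i)))) = f x" if "finite S" for S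
    using that
  proof (induction S)
    case (insert j S)
    have "f (x + (\<Sum>i\<in>insert j S. axis i (2 * pi * of_int (m i)))) =
      f (x + (\<Sum>i\<in>S. axis i (2 * pi * of_int (m i))) + axis j (2 * pi * of_int (m j)))"
      using insert by (simp add: ac_simps)
    then show ?case using one insert.IH by simp
  qed simp
  moreover have "(\<Sum>i\<in>UNIV. axis i (2 * pi * of_int (m i))) = ((\<chi> i. 2 * pi * of_int (m i)) :: real^'n)"
    by (simp add: vec_eq_iff axis_def)
  ultimately show ?thesis by (metis finite)
qed

text \<open>All values are already taken on the compact fundamental cube.\<close>

lemma bounded_range_torus_periodic:
  fixes f :: "real^'n \<Rightarrow> 'b::real_normed_vector"
  assumes per: "torus_periodic f" and cont: "continuous_on UNIV f"
  shows "bounded (range f)"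
proof -
  have "f x \<in> f ` cbox 0 (\<chi> i. 2 * pi)" for x
  proof
    \<comment> \<open>The representative of \<open>x\<close> modulo the lattice whose coordinates
      are the remainders modulo \<open>2 * pi\<close>.\<close>
    let ?y = "x + (\<chi> i. 2 * pi * of_int (- \<lfloor>x $ i / (2 * pi)\<rfloor>))"
    show "f x = f ?y"
      using torus_periodic_shift[OF per, of x "\<lambda>i. - \<lfloor>x $ i / (2 * pi)\<rfloor>"] by simp
    have "2 * pi * \<lfloor>a / (2 * pi)\<rfloor> \<le> a" "a \<le> 2 * pi * \<lfloor>a / (2 * pi)\<rfloor> + 2 * pi" for a
    proof -
      define q where "q = a / (2 * pi)"
      have a: "a = 2 * pi * q" by (simp add: q_def)
      have "2 * pi * \<lfloor>q\<rfloor> \<le> 2 * pi * q" "2 * pi * q \<le> 2 * pi * (\<lfloor>q\<rfloor> + 1)"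
        by (intro mult_left_mono; linarith | simp)+
      then show "2 * pi * \<lfloor>a / (2 * pi)\<rfloor> \<le> a" "a \<le> 2 * pi * \<lfloor>a / (2 * pi)\<rfloor> + 2 * pi"
        unfolding q_def[symmetric] by (simp_all add: a distrib_left)
    qed
    then show "?y \<in> cbox 0 (\<chi> i. 2 * pi)"
      by (auto simp: mem_box_cart algebra_simps)
  qed
  then have "range f \<subseteq> f ` cbox 0 (\<chi> i. 2 * pi)" by blast
  moreover have "compact (f ` cbox 0 (\<chi> i. 2 * pi))"
    using cont by (meson compact_cbox compact_continuous_image continuous_on_subset top_greatest)
  ultimately show ?thesis
    using bounded_subset compact_imp_bounded by blast
qed

text \<open>Differentiate the periodicity identity by the chain rule and use uniqueness of the
  derivative.\<close>

lemma torus_periodic_frechet_derivative: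
  fixes f :: "real^'n \<Rightarrow> 'b::real_normed_vector"
  assumes per: "torus_periodic f" and diff: "\<And>x. f differentiable (at x)"
  shows "torus_periodic (\<lambda>x. frechet_derivative f (at x) h)"
  unfolding torus_periodic_def
proof (intro allI)
  fix x :: "real^'n" and i :: 'n
  let ?c = "axis i (2 * pi) :: real^'n"
  have "(f has_derivative frechet_derivative f (at (x + ?c))) (at (x + ?c))"
    using diff frechet_derivative_works by blast
  moreover have "((\<lambda>y. y + ?c) has_derivative (\<lambda>h. h)) (at x)"
    by (auto intro!: derivative_eq_intros)
  ultimately have "((\<lambda>y. f (y + ?c)) has_derivative frechet_derivative f (at (x + ?c))) (at x)"
    using has_derivative_compose[of "\<lambda>y. y + ?c" "\<lambda>h. h" x UNIV f] by simp
  then have "(f has_derivative frechet_derivative f (at (x + ?c))) (at x)"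
    using per by (simp add: torus_periodic_def)
  then show "frechet_derivative f (at (x + ?c)) h = frechet_derivative f (at x) h"
    by (metis frechet_derivative_at)
qed

text \<open>\<open>C_k\<close> speaks of derivatives in basis directions only; this expansion
  carries bounds and continuity over to arbitrary directions.\<close>

lemma linear_eq_sum_Basis:
  fixes D :: "'a::euclidean_space \<Rightarrow> 'b::real_vector"
  assumes "linear D"
  shows "D h = (\<Sum>b\<in>Basis. (h \<bullet> b) *\<^sub>R D b)"
proof -
  have "D h = D (\<Sum>b\<in>Basis. (h \<bullet> b) *\<^sub>R b)"
    by (simp add: euclidean_representation)
  then show ?thesis
    by (simp only: linear_sum[OF assms] linear_scale[OF assms])
qed

lemma bounded_partials_imp_lipschitz:
  fixes f :: "'a::euclidean_space \<Rightarrow> 'b::real_normed_vector"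
  assumes der: "\<And>x. (f has_derivative D x) (at x)"
    and bdd: "\<And>b. b \<in> Basis \<Longrightarrow> bounded (range (\<lambda>x. D x b))"
  obtains L where "L-lipschitz_on UNIV f"
proof -
  have "\<exists>B. \<forall>x. norm (D x b) \<le> B" if "b \<in> Basis" for b
    using bdd[OF that] unfolding bounded_iff by blast
  then obtain B where B: "\<And>b x. b \<in> Basis \<Longrightarrow> norm (D x b) \<le> B b"
    by metis
  have le: "norm (D x h) \<le> (\<Sum>b\<in>Basis. B b) * norm h" for x h
  proof -
    have "norm (D x h) \<le> (\<Sum>b\<in>Basis. norm ((h \<bullet> b) *\<^sub>R D x b))"
      using linear_eq_sum_Basis[OF has_derivative_linear[OF der], of x h] by (metis norm_sum)
    also have "\<dots> \<le> (\<Sum>b\<in>Basis. norm h * B b)"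
      using B by (intro sum_mono) (auto intro!: mult_mono simp: Basis_le_norm)
    finally show ?thesis by (simp add: sum_distrib_left mult.commute)
  qed
  have nonneg: "0 \<le> (\<Sum>b\<in>Basis. B b)"
    using B by (meson norm_ge_zero order_trans sum_nonneg)
  have "(\<Sum>b\<in>Basis. B b)-lipschitz_on UNIV f"
    by (rule bounded_derivative_imp_lipschitz[where f' = D])
      (use der nonneg le in \<open>auto intro!: onorm_bound\<close>)
  then show ?thesis using that by blast
qed

text \<open>Second derivatives of a smooth periodic function are continuous and periodic, hence
  bounded, so the gradient is globally Lipschitz. The derivative \<open>D\<close> is kept because it
  enters the momentum error.\<close>

lemma smooth_grad:
  fixes v :: "real^'n \<Rightarrow> real"
  assumes smooth: "smooth v" and per: "torus_periodic v"
  obtains D L where "\<And>x. (grad v has_derivative D x) (at x)"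
    and "\<And>b. b \<in> Basis \<Longrightarrow> continuous_on UNIV (\<lambda>x. D x b)"
    and "L-lipschitz_on UNIV (grad v)"
proof -
  let ?d = "\<lambda>i x. frechet_derivative v (at x) (axis i 1)"
  define D where "D x h = (\<chi> i. frechet_derivative (?d i) (at x) h)" for x h
  have "C_k (Suc (Suc 0)) v"
    using smooth unfolding smooth_def by blast
  then have dv: "v differentiable (at x)" and ddv: "?d i differentiable (at x)"
    and cont: "b \<in> Basis \<Longrightarrow> continuous_on UNIV (\<lambda>x. frechet_derivative (?d i) (at x) b)" for x i b
    by (auto simp: axis_in_Basis_iff)
  have "(?d i has_derivative frechet_derivative (?d i) (at x)) (at x)" for i x
    using ddv frechet_derivative_works by blast
  then have der: "(grad v has_derivative D x) (at x)" for x
    unfolding has_derivative_componentwise_within[of "grad v"]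
    by (auto simp: Basis_vec_def inner_axis grad_def D_def)
  have contD: "continuous_on UNIV (\<lambda>x. D x b)" if "b \<in> Basis" for b
    unfolding D_def by (intro continuous_on_vec_lambda cont that)
  have "torus_periodic (\<lambda>x. frechet_derivative (?d i) (at x) b)" for i b
    by (intro torus_periodic_frechet_derivative per dv ddv)
  then have "torus_periodic (\<lambda>x. D x b)" for b
    by (simp add: torus_periodic_def D_def)
  then have "bounded (range (\<lambda>x. D x b))" if "b \<in> Basis" for b
    using bounded_range_torus_periodic contD that by blast
  then obtain L where "L-lipschitz_on UNIV (grad v)"
    using bounded_partials_imp_lipschitz[OF der] by blast
  with that der contD show ?thesis by blast
qed

section \<open>Integrals over the torus\<close>

text \<open>Passing to the gauge integral gives access to parameter integrals and to the exchange of
  integrals for continuous integrands.\<close>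

lemma torus_integral_eq:
  fixes f :: "real^'n \<Rightarrow> real"
  assumes "continuous_on UNIV f"
  shows "torus_integral f = integral (cbox 0 (\<chi> i. 2 * pi)) f"
proof -
  have "set_integrable lborel (cbox 0 (\<chi> i. 2 * pi)) f"
    unfolding set_integrable_def
    using assms by (intro borel_integrable_compact compact_cbox) (rule continuous_on_subset, auto)
  then show ?thesis
    unfolding torus_integral_def by (rule set_borel_integral_eq_integral)
qed

text \<open>A nonnegative continuous function with zero integral vanishes on the whole cube, in
  particular at the corner 0. The result is applied to the normalising constant of
  \<open>sigma_k\<close>.\<close>

lemma torus_integral_pos:
  fixes f :: "real^'n \<Rightarrow> real"
  assumes cont: "continuous_on UNIV f" and pos: "\<And>x. f x > 0"
  shows "torus_integral f > 0"
proof -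
  let ?Q = "cbox 0 (\<chi> i. 2 * pi) :: (real^'n) set"
  have c: "continuous_on ?Q f"
    using cont continuous_on_subset by blast
  have ne: "box 0 (\<chi> i. 2 * pi) \<noteq> ({} :: (real^'n) set)"
    by (simp add: interval_ne_empty_cart)
  have nonneg: "integral ?Q f \<ge> 0"
    using c pos by (intro integral_nonneg integrable_continuous) (auto intro: less_imp_le)
  have "integral ?Q f \<noteq> 0"
  proof
    assume "integral ?Q f = 0"
    then have "\<forall>x\<in>?Q. f x = 0"
      using has_integral_0_cbox_imp_0[OF c _ _ ne] pos integrable_integral[OF integrable_continuous[OF c]]
      by (metis less_imp_le)
    then have "f 0 = 0"
      by (simp add: mem_box_cart)
    with pos[of 0] show False by simp
  qed
  with nonneg show ?thesis
    by (simp add: torus_integral_eq[OF cont])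
qed

lemma torus_integral_mono:
  fixes f g :: "real^'n \<Rightarrow> real"
  assumes f: "continuous_on UNIV f" and g: "continuous_on UNIV g" and le: "\<And>x. f x \<le> g x"
  shows "torus_integral f \<le> torus_integral g"
  unfolding torus_integral_eq[OF f] torus_integral_eq[OF g]
  using f g le
  by (intro integral_le integrable_continuous) (auto intro: continuous_on_subset)

text \<open>Stands in for the Cauchy-Schwarz inequality: the pointwise bound
  \<open>a \<le> (1 / c + c * a\<^sup>2) / 2\<close> is integrated, and \<open>c\<close> is left
  free for balancing the two terms.\<close>

lemma torus_integral_weighted_am_gm:
  fixes g \<sigma> :: "real^'n \<Rightarrow> real"
  assumes g: "continuous_on UNIV g" and \<sigma>: "continuous_on UNIV \<sigma>"
    and nonneg: "\<And>x. \<sigma> x \<ge> 0" and c: "c > 0"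
  shows "torus_integral (\<lambda>x. g x * \<sigma> x)
    \<le> (torus_integral \<sigma> / c + c * torus_integral (\<lambda>x. (g x)\<^sup>2 * \<sigma> x)) / 2"
proof -
  let ?Q = "cbox 0 (\<chi> i. 2 * pi) :: (real^'n) set"
  have cont: "continuous_on UNIV (\<lambda>x. (g x)\<^sup>2 * \<sigma> x)"
    by (intro continuous_intros g \<sigma>)
  have int: "f integrable_on ?Q" if "continuous_on UNIV f" for f :: "real^'n \<Rightarrow> real"
    using that by (meson continuous_on_subset integrable_continuous top_greatest)
  have "a \<le> (1 / c + c * a\<^sup>2) / 2" for a
  proof -
    have "0 \<le> (c * a - 1)\<^sup>2 / c" using c by simp
    also have "\<dots> = 1 / c + c * a\<^sup>2 - 2 * a"
      using c by (simp add: power2_eq_square field_simps)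
    finally show ?thesis by simp
  qed
  from mult_right_mono[OF this nonneg]
  have "torus_integral (\<lambda>x. g x * \<sigma> x) \<le> torus_integral (\<lambda>x. (1 / c + c * (g x)\<^sup>2) / 2 * \<sigma> x)"
    by (intro torus_integral_mono continuous_intros g \<sigma>) auto
  also have "\<dots> = integral ?Q (\<lambda>x. \<sigma> x / (2 * c) + c / 2 * ((g x)\<^sup>2 * \<sigma> x))"
    by (subst torus_integral_eq) (intro continuous_intros g \<sigma> | simp add: field_simps)+
  also have "\<dots> = integral ?Q \<sigma> / (2 * c) + c / 2 * integral ?Q (\<lambda>x. (g x)\<^sup>2 * \<sigma> x)"
    using int[OF \<sigma>] int[OF cont] by (subst integral_add) (auto intro!: integrable_on_divide integrable_on_mult_right)
  also have "\<dots> = (torus_integral \<sigma> / c + c * torus_integral (\<lambda>x. (g x)\<^sup>2 * \<sigma> x)) / 2"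
    unfolding torus_integral_eq[OF \<sigma>] torus_integral_eq[OF cont] by (simp add: add_divide_distrib)
  finally show ?thesis .
qed

text \<open>After integrating the pointwise Gronwall bound against the weight and exchanging the
  integrals, the inner space integral is at most \<open>M\<close> at every time, and the remaining
  time integral is explicit.\<close>

lemma torus_integral_gronwall_bound:
  fixes G :: "real \<Rightarrow> real^'n \<Rightarrow> real" and d \<sigma> :: "real^'n \<Rightarrow> real"
  assumes G: "continuous_on UNIV (\<lambda>z. G (fst z) (snd z))"
    and \<sigma>: "continuous_on UNIV \<sigma>" and nonneg: "\<And>x. \<sigma> x \<ge> 0"
    and d: "continuous_on UNIV d"
    and d_le: "\<And>x. d x \<le> exp (L * T) * integral {0..T} (\<lambda>s. exp (- L * s) * G s x)"
    and M: "\<And>s. torus_integral (\<lambda>x. G s x * \<sigma> x) \<le> M"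
    and L: "L > 0" and T: "T \<ge> 0"
  shows "torus_integral (\<lambda>x. d x * \<sigma> x) \<le> (exp (L * T) - 1) / L * M"
proof -
  let ?Q = "cbox 0 (\<chi> i. 2 * pi) :: (real^'n) set"
  let ?f = "\<lambda>x s. exp (- L * s) * (G s x * \<sigma> x)"
  have G': "continuous_on S (\<lambda>y. G (a y) (b y))"
    if "continuous_on S a" "continuous_on S b" for S :: "'c::topological_space set" and a b
    using continuous_on_compose2[OF G continuous_on_Pair[OF that]] by simp
  have \<sigma>': "continuous_on S (\<lambda>y. \<sigma> (b y))"
    if "continuous_on S b" for S :: "'c::topological_space set" and b
    using continuous_on_compose2[OF \<sigma> that] by simp
  have f: "continuous_on S (\<lambda>(x, s). ?f x s)" for S
    unfolding case_prod_unfold by (intro continuous_intros G' \<sigma>')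
  have f': "continuous_on S (\<lambda>(s, x). ?f x s)" for S
    unfolding case_prod_unfold by (intro continuous_intros G' \<sigma>')
  have intf: "continuous_on S (\<lambda>x. integral {0..T} (?f x))" for S
    using integral_continuous_on_param[of S 0 T ?f] f by simp
  have dM: "((\<lambda>s. exp (- L * s) * M) has_integral (1 - exp (- L * T)) / L * M) {0..T}"
  proof -
    have "((\<lambda>s. exp (- L * s) * M) has_integral
      - exp (- L * T) / L * M - (- exp (- L * 0) / L * M)) {0..T}"
      using L by (intro fundamental_theorem_of_calculus T)
        (auto intro!: derivative_eq_intros simp: has_real_derivative_iff_has_vector_derivative[symmetric])
    then show ?thesis using L by (simp add: field_simps)
  qed
  have "torus_integral (\<lambda>x. d x * \<sigma> x) \<le> torus_integral (\<lambda>x. exp (L * T) * integral {0..T} (?f x))"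
  proof (rule torus_integral_mono)
    \<comment> \<open>The weight is constant in time and moves under the time integral.\<close>
    show "d x * \<sigma> x \<le> exp (L * T) * integral {0..T} (?f x)" for x
      using mult_right_mono[OF d_le nonneg, of x x] by (simp flip: integral_mult_left add: mult.assoc)
  qed (intro continuous_intros d \<sigma> intf)+
  also have "\<dots> = exp (L * T) * integral ?Q (\<lambda>x. integral {0..T} (?f x))"
    by (subst torus_integral_eq) (intro continuous_intros intf, simp)
  also have "integral ?Q (\<lambda>x. integral {0..T} (?f x)) = integral {0..T} (\<lambda>s. integral ?Q (\<lambda>x. ?f x s))"
    using integral_swap_continuous[of 0 0 _ T ?f] f by simp
  also have "exp (L * T) * \<dots> \<le> exp (L * T) * integral {0..T} (\<lambda>s. exp (- L * s) * M)"
  proof (intro mult_left_mono integral_le)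
    show "(\<lambda>s. integral ?Q (\<lambda>x. ?f x s)) integrable_on {0..T}"
      by (intro integrable_continuous_real integral_continuous_on_param f')
    show "integral ?Q (\<lambda>x. ?f x s) \<le> exp (- L * s) * M" for s
    proof -
      have "continuous_on UNIV (\<lambda>x. G s x * \<sigma> x)"
        by (intro continuous_intros G' \<sigma>)
      then show ?thesis
        using M[of s] by (simp add: torus_integral_eq)
    qed
  qed (use dM in auto)
  also have "\<dots> = exp (L * T) * ((1 - exp (- L * T)) / L * M)"
    by (simp only: integral_unique[OF dM])
  also have "\<dots> = (exp (L * T) - exp (L * T) * exp (- L * T)) / L * M"
    by (simp add: algebra_simps)
  also have "exp (L * T) * exp (- L * T) = 1"
    by (simp flip: exp_add)
  finally show ?thesis .
qed

section \<open>The averaged distance between the two flows\<close>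

text \<open>The exponent contains \<open>\<bar>t\<bar>\<close>: for negative \<open>t\<close> the
  factor \<open>exp (lam * t) - 1\<close> would be negative, whereas the integral on the left is
  nonnegative. For \<open>t \<ge> 0\<close> nothing changes.\<close>

theorem proposition2p1:
  fixes H :: "(real^'n) \<times> (real^'n) \<Rightarrow> real"
    and u :: "nat \<Rightarrow> real^'n \<Rightarrow> real^'n \<Rightarrow> real"
    and Cf :: "nat \<Rightarrow> real^'n \<Rightarrow> real \<Rightarrow> real^'n \<Rightarrow> real^'n"
    and PhiH :: "real \<Rightarrow> (real^'n) \<times> (real^'n) \<Rightarrow> (real^'n) \<times> (real^'n)"
    and lam R CR :: real
  assumes H_smooth: "smooth H"
    and H_periodic: "\<And>I. torus_periodic (\<lambda>\<phi>. H (I, \<phi>))"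
    and H_convex: "\<And>\<phi>. convex_on UNIV (\<lambda>I. H (I, \<phi>))"
    and H_bounds: "hessian_bounds H"
    and u_min: "\<And>k I. k \<ge> 1 \<Longrightarrow> is_unique_minimizer H k I (u k I)"
    and C_flow: "\<And>k I. k \<ge> 1 \<Longrightarrow> is_flow (angle_field H u k I) (Cf k I)"
    and H_flow: "is_flow (hamiltonian_field H) PhiH"
    and lambda_pos: "lam > 0"
    and H_lipschitz: "lam-lipschitz_on UNIV (hamiltonian_field H)"
    and R_pos: "R > 0"
    and CR_pos: "CR > 0"
    and CR_bound: "\<And>t k I. k \<ge> 1 \<Longrightarrow> norm I \<le> R \<Longrightarrow>
      torus_integral (\<lambda>\<phi>.
        (norm (vector_derivative (\<lambda>s. fst (Phi u Cf k s I \<phi>)) (at t)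
               + dH_dphi H (Phi u Cf k t I \<phi>)))\<^sup>2 * sigma_k H u k I \<phi>) \<le> CR / real k"
  shows "(\<forall>t k I. k \<ge> 1 \<longrightarrow> norm I \<le> R \<longrightarrow>
           torus_integral (\<lambda>\<phi>. flow_dist u Cf PhiH k t I \<phi> * sigma_k H u k I \<phi>)
             \<le> (exp (lam * \<bar>t\<bar>) - 1) * (1 + CR) / (lam * sqrt (real k))) \<and>
         (\<forall>t I. norm I \<le> R \<longrightarrow>
           (\<lambda>k. torus_integral (\<lambda>\<phi>. flow_dist u Cf PhiH k t I \<phi> * sigma_k H u k I \<phi>))
             \<longlonglongrightarrow> 0)"
proof -
  let ?X = "hamiltonian_field H"
  have bound: "torus_integral (\<lambda>\<phi>. flow_dist u Cf PhiH k t I \<phi> * sigma_k H u k I \<phi>)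
      \<le> (exp (lam * \<bar>t\<bar>) - 1) * (1 + CR) / (lam * sqrt (real k))"
    and nonneg: "0 \<le> torus_integral (\<lambda>\<phi>. flow_dist u Cf PhiH k t I \<phi> * sigma_k H u k I \<phi>)"
    if k: "k \<ge> 1" and I: "norm I \<le> R" for t k I
  proof -
    define U where "U = U_I u k I"
    define A where "A = angle_field H u k I"
    define \<sigma> where "\<sigma> = sigma_k H u k I"
    define F where "F = Cf k I"
    have "smooth (u k I)" "torus_periodic (u k I)"
      using u_min[OF k] by (auto simp: is_unique_minimizer_def is_minimizer_def)
    then obtain D L where der: "\<And>x. (grad (u k I) has_derivative D x) (at x)"
      and contD: "\<And>b. b \<in> Basis \<Longrightarrow> continuous_on UNIV (\<lambda>x. D x b)"
      and lip: "L-lipschitz_on UNIV (grad (u k I))"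
      using smooth_grad by blast
    have derU: "(U has_derivative D x) (at x)" for x
      unfolding U_def U_I_def by (auto intro!: derivative_eq_intros der)
    have UL: "norm (U x - U y) \<le> L * norm (x - y)" for x y
      using lipschitz_on_normD[OF lip, of x y] by (simp add: U_def U_I_def)
    have XL: "norm (?X x - ?X y) \<le> lam * norm (x - y)" for x y
      using lipschitz_on_normD[OF H_lipschitz] by simp
    \<comment> \<open>The angle field is the angular part of the Hamiltonian field on the graph of
      \<open>U\<close>, so it inherits a Lipschitz constant; the factor \<open>L + 1\<close> below
      bounds the stretching of \<open>x\<close> to \<open>(U x, x)\<close>.\<close>
    have A_eq: "A x = snd (?X (U x, x))" for x
      by (simp add: A_def angle_field_def U_def hamiltonian_field_def)
    have A_lip: "(lam * (L + 1))-lipschitz_on UNIV A"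
    proof (rule lipschitz_onI)
      fix x y
      have "norm (A x - A y) \<le> norm (?X (U x, x) - ?X (U y, y))"
        using dist_snd_le[of "?X (U x, x)" "?X (U y, y)"] by (simp add: A_eq dist_norm)
      also have "\<dots> \<le> lam * norm (U x - U y, x - y)"
        using XL[of "(U x, x)" "(U y, y)"] by simp
      also have "\<dots> \<le> lam * (norm (U x - U y) + norm (x - y))"
        using lambda_pos by (intro mult_left_mono norm_Pair_le) auto
      also have "\<dots> \<le> lam * (L * norm (x - y) + norm (x - y))"
        using lambda_pos UL by (intro mult_left_mono add_right_mono) auto
      finally show "dist (A x) (A y) \<le> lam * (L + 1) * dist x y"
        by (simp add: dist_norm algebra_simps)
    qed (use lambda_pos lipschitz_on_nonneg[OF lip] in simp)
    have flowF: "is_flow A F"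
      using C_flow[OF k] by (simp add: A_def F_def)
    have dF: "((\<lambda>s. F s x) has_vector_derivative A (F s x)) (at s)" and F0: "F 0 x = x" for s x
      using flowF by (auto simp: is_flow_def)
    have dPhiH: "((\<lambda>s. PhiH s z) has_vector_derivative ?X (PhiH s z)) (at s)"
      and PhiH0: "PhiH 0 z = z" for s z
      using H_flow unfolding is_flow_def by blast+
    have contX: "continuous_on UNIV ?X" and contA: "continuous_on UNIV A"
      using H_lipschitz A_lip lipschitz_on_continuous_on by blast+
    have contU: "continuous_on UNIV U"
      using derU by (meson has_derivative_continuous continuous_at_imp_continuous_on)
    have cU: "continuous_on S (\<lambda>y. U (b y))" if "continuous_on S b"
      for S :: "'c::topological_space set" and b
      using continuous_on_compose2[OF contU that] by simp
    have cF: "continuous_on S (\<lambda>y. F (a y) (b y))" if "continuous_on S a" "continuous_on S b"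
      for S :: "'c::topological_space set" and a b
      using continuous_on_compose2[OF continuous_on_flow[OF A_lip flowF] continuous_on_Pair[OF that]]
      by simp
    have cPhiH: "continuous_on S (\<lambda>y. PhiH (a y) (b y))" if "continuous_on S a" "continuous_on S b"
      for S :: "'c::topological_space set" and a b
      using continuous_on_compose2[OF continuous_on_flow[OF H_lipschitz H_flow] continuous_on_Pair[OF that]]
      by simp
    \<comment> \<open>The momentum error as a function of the angle alone: \<open>D x (A x)\<close>
      is the derivative of \<open>U\<close> along the flow of \<open>A\<close>, so the error at time
      \<open>s\<close> is \<open>e (F s x)\<close>.\<close>
    define e where "e x = D x (A x) + dH_dphi H (U x, x)" for x
    have conte: "continuous_on UNIV e"
    proof -
      \<comment> \<open>Every term is now visibly continuous: \<open>D x b\<close> for basis vectors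
        \<open>b\<close>, and the \<open>\<phi>\<close>-gradient of \<open>H\<close> as a component
        of the Lipschitz field.\<close>
      have "e x = (\<Sum>b\<in>Basis. (A x \<bullet> b) *\<^sub>R D x b) - fst (?X (U x, x))" for x
        using linear_eq_sum_Basis[OF has_derivative_linear[OF der], of x "A x"]
        by (simp add: e_def hamiltonian_field_def)
      moreover have "continuous_on UNIV (\<lambda>x. (\<Sum>b\<in>Basis. (A x \<bullet> b) *\<^sub>R D x b) - fst (?X (U x, x)))"
        by (intro continuous_intros contA contD cU continuous_on_compose2[OF contX]) auto
      ultimately show ?thesis by simp
    qed
    have Phi_eq: "Phi u Cf k s I x = (U (F s x), F s x)" for s x
      by (simp add: Phi_def U_def F_def)
    have dUF: "((\<lambda>s. U (F s x)) has_vector_derivative D (F s x) (A (F s x))) (at s)" for s x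
      using has_derivative_compose[OF dF[unfolded has_vector_derivative_def] derU, of x s]
        linear_scale[OF has_derivative_linear[OF derU]]
      by (simp add: has_vector_derivative_def)
    have e_eq: "vector_derivative (\<lambda>s. fst (Phi u Cf k s I x)) (at s) + dH_dphi H (Phi u Cf k s I x)
        = e (F s x)" for s x
      using vector_derivative_at[OF dUF] by (simp add: Phi_eq e_def)
    have contG: "continuous_on UNIV (\<lambda>z. norm (e (F (sgn t * fst z) (snd z))))"
      by (intro continuous_intros continuous_on_compose2[OF conte] cF) auto
    have contGs: "continuous_on UNIV (\<lambda>x. norm (e (F s x)))" for s
      by (intro continuous_intros continuous_on_compose2[OF conte] cF) auto
    have contd: "continuous_on UNIV (flow_dist u Cf PhiH k t I)"
      unfolding flow_dist_def Phi_eq U_def[symmetric] by (intro continuous_intros cU cF cPhiH)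
    have contH: "continuous_on UNIV H"
      using H_smooth C_k.simps(1) unfolding smooth_def by blast
    have cont_exp: "continuous_on UNIV (\<lambda>x. exp (real k * H (U x, x)))"
      by (intro continuous_intros cU continuous_on_compose2[OF contH]) auto
    have Z_pos: "exp_functional H k I (u k I) > 0"
      unfolding exp_functional_def U_I_def[symmetric] U_def[symmetric]
      by (rule torus_integral_pos[OF cont_exp]) simp
    \<comment> \<open>Positivity of the normalising constant lets \<open>exp\<close> undo the
      logarithm in \<open>H_bar\<close>.\<close>
    have \<sigma>_eq: "\<sigma> = (\<lambda>x. exp (real k * H (U x, x)) / exp_functional H k I (u k I))"
      using k Z_pos
      by (simp add: \<sigma>_def sigma_k_def H_bar_def U_def right_diff_distrib exp_diff fun_eq_iff)
    have cont\<sigma>: "continuous_on UNIV \<sigma>"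
      unfolding \<sigma>_eq using Z_pos by (intro continuous_intros cont_exp) auto
    have \<sigma>_pos: "\<sigma> x \<ge> 0" for x
      by (simp add: \<sigma>_def sigma_k_def)
    have \<sigma>_1: "torus_integral \<sigma> = 1"
    proof -
      have "torus_integral (\<lambda>x. exp (real k * H (U x, x))) = exp_functional H k I (u k I)"
        by (simp add: exp_functional_def U_def U_I_def)
      then show ?thesis
        using Z_pos cont\<sigma>
        by (simp add: torus_integral_eq[OF cont_exp] torus_integral_eq \<sigma>_eq)
    qed
    \<comment> \<open>The choice \<open>c = sqrt k\<close> makes both terms of order
      \<open>1 / sqrt k\<close>; the leftover factor 1/2 is discarded.\<close>
    have mean: "torus_integral (\<lambda>x. norm (e (F s x)) * \<sigma> x) \<le> (1 + CR) / sqrt k" for s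
    proof -
      have "torus_integral (\<lambda>x. norm (e (F s x)) * \<sigma> x)
          \<le> (torus_integral \<sigma> / sqrt k + sqrt k * torus_integral (\<lambda>x. (norm (e (F s x)))\<^sup>2 * \<sigma> x)) / 2"
        using k by (intro torus_integral_weighted_am_gm contGs cont\<sigma> \<sigma>_pos) simp
      also have "\<dots> \<le> (1 / sqrt k + sqrt k * (CR / k)) / 2"
        using CR_bound[OF k I, of s] unfolding e_eq \<sigma>_def[symmetric] \<sigma>_1
        by (intro divide_right_mono add_left_mono mult_left_mono) simp_all
      also have "sqrt k * (CR / k) = CR / sqrt k"
        using k by (simp add: field_simps)
      also have "(1 / sqrt k + CR / sqrt k) / 2 \<le> (1 + CR) / sqrt k"
        using CR_pos k by (simp add: field_simps)
      finally show ?thesis .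
    qed
    have d_le: "flow_dist u Cf PhiH k t I x \<le> exp (lam * \<bar>t\<bar>) *
        integral {0..\<bar>t\<bar>} (\<lambda>s. exp (- lam * s) * norm (e (F (sgn t * s) x)))" for x
    proof -
      \<comment> \<open>Both curves start at \<open>(U x, x)\<close>, so the initial term of the
        Gronwall bound vanishes.\<close>
      let ?w = "\<lambda>s. (U (F s x), F s x) - PhiH s (U x, x)"
      have "norm (?w t) \<le> exp (lam * \<bar>t\<bar>) * (norm (?w 0) +
        integral {0..\<bar>t\<bar>} (\<lambda>s. exp (- lam * s) * norm (e (F (sgn t * s) x))))"
      proof (rule gronwall_norm_abs)
        fix s
        let ?f = "(D (F s x) (A (F s x)), A (F s x)) - ?X (PhiH s (U x, x))"
        show "(?w has_vector_derivative ?f) (at s)"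
          by (intro has_vector_derivative_diff has_vector_derivative_Pair dUF dF dPhiH)
        \<comment> \<open>The angular equation holds exactly along the approximate curve, so the
          error has only a momentum component.\<close>
        have "?f = (?X (U (F s x), F s x) - ?X (PhiH s (U x, x))) + (e (F s x), 0)"
          by (simp add: e_def A_eq hamiltonian_field_def prod_eq_iff)
        then have "norm ?f \<le> norm (?X (U (F s x), F s x) - ?X (PhiH s (U x, x))) + norm (e (F s x), 0 :: real^'n)"
          by (metis norm_triangle_ineq)
        also have "\<dots> \<le> lam * norm (?w s) + norm (e (F s x))"
          using XL by (simp add: norm_Pair)
        finally show "norm ?f \<le> lam * norm (?w s) + norm (e (F s x))" .
        show "continuous_on UNIV (\<lambda>s. norm (e (F s x)))"
          by (intro continuous_intros continuous_on_compose2[OF conte] cF) auto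
      qed (use lambda_pos in auto)
      then show ?thesis
        by (simp add: flow_dist_def Phi_eq U_def[symmetric] F0 PhiH0)
    qed
    have "torus_integral (\<lambda>x. flow_dist u Cf PhiH k t I x * \<sigma> x)
        \<le> (exp (lam * \<bar>t\<bar>) - 1) / lam * ((1 + CR) / sqrt k)"
      by (rule torus_integral_gronwall_bound[OF contG cont\<sigma> \<sigma>_pos contd d_le mean])
        (use lambda_pos in auto)
    then show "torus_integral (\<lambda>\<phi>. flow_dist u Cf PhiH k t I \<phi> * sigma_k H u k I \<phi>)
      \<le> (exp (lam * \<bar>t\<bar>) - 1) * (1 + CR) / (lam * sqrt (real k))"
      by (simp add: \<sigma>_def)
    have "torus_integral (\<lambda>x :: real^'n. 0) \<le> torus_integral (\<lambda>x. flow_dist u Cf PhiH k t I x * \<sigma> x)"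
      using \<sigma>_pos by (intro torus_integral_mono continuous_intros contd cont\<sigma>) (simp add: flow_dist_def)
    then show "0 \<le> torus_integral (\<lambda>\<phi>. flow_dist u Cf PhiH k t I \<phi> * sigma_k H u k I \<phi>)"
      by (simp add: \<sigma>_def torus_integral_def)
  qed
  have "(\<lambda>k. torus_integral (\<lambda>\<phi>. flow_dist u Cf PhiH k t I \<phi> * sigma_k H u k I \<phi>)) \<longlonglongrightarrow> 0"
    if I: "norm I \<le> R" for t I
  \<comment> \<open>The two-sided bounds hold from \<open>k = 1\<close> on, which suffices for the
    limit.\<close>
  proof (rule tendsto_sandwich[OF _ _ tendsto_const])
    show "(\<lambda>k. (exp (lam * \<bar>t\<bar>) - 1) * (1 + CR) / (lam * sqrt (real k))) \<longlonglongrightarrow> 0"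
    proof (rule tendsto_divide_0[OF tendsto_const filterlim_at_top_imp_at_infinity])
      show "filterlim (\<lambda>k. lam * sqrt (real k)) at_top sequentially"
        using lambda_pos
        by (intro filterlim_tendsto_pos_mult_at_top[OF tendsto_const]
            filterlim_compose[OF sqrt_at_top] filterlim_real_sequentially)
    qed
  qed (use bound[OF _ I] nonneg[OF _ I] in \<open>auto intro: eventually_sequentiallyI[of 1]\<close>)
  with bound show ?thesis by blast
qed

end
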